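(* Let $D$ be a division ring, and let $a\in M_2(D)$. Then there exist $b,c,d,e\in M_2(D)$ such that $a=[b,c][d,e]$, and such that $[b,c]$ and $d$ are invertible. In particular, every matrix in $M_2(D)$ is a product of two commutators.
   Context: The commutator of $x,y$ in a ring is the additive commutator $[x,y]=xy-yx$. *)

theory Defs
  imports "HOL-Analysis.Analysis"
begin

(* The ring product of square matrices is **; the operator * on vec types is componentwise. *)
definition mat_commutator :: "'a::ring_1^'n^'n \<Rightarrow> 'a^'n^'n \<Rightarrow> 'a^'n^'n" where
  "mat_commutator x y = x ** y - y ** x"

end

theory Submission
  imports Defs
begin

text \<open>
  The property is invariant under similarity. A matrix with zero diagonal is a commutator
  of an invertible matrix with \<open>diag(1, 0)\<close>. Triangular matrices with diagonal \<open>(1, -1)\<close>,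
  as well as the coordinate swap, are invertible commutators. Multiplying one of these
  with a matrix with zero diagonal yields every diagonal matrix and every matrix with
  rows \<open>(0, b)\<close>, \<open>(c, d)\<close> where \<open>d\<close> is a left multiple of \<open>b\<close>. Conjugation by
  elementary matrices and by the coordinate swap brings every matrix into one of these forms.
\<close>

definition mat2 :: "'a \<Rightarrow> 'a \<Rightarrow> 'a \<Rightarrow> 'a \<Rightarrow> 'a::zero^2^2" where
  "mat2 p q r s = vector [vector [p, q], vector [r, s]]"

lemma mat2_eta: "a = mat2 (a$1$1) (a$1$2) (a$2$1) (a$2$2)"
  by (simp add: mat2_def vec_eq_iff forall_2 vector_2)

lemma mat2_mult:
  fixes p :: "'a::semiring_1"
  shows "mat2 p q r s ** mat2 p' q' r' s' =
    mat2 (p * p' + q * r') (p * q' + q * s') (r * p' + s * r') (r * q' + s * s')"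
  by (simp add: mat2_def matrix_matrix_mult_def vec_eq_iff forall_2 vector_2 sum_2)

lemma mat2_diff:
  fixes p :: "'a::group_add"
  shows "mat2 p q r s - mat2 p' q' r' s' = mat2 (p - p') (q - q') (r - r') (s - s')"
  by (simp add: mat2_def vec_eq_iff forall_2 vector_2)

lemma mat2_one: "mat 1 = (mat2 1 0 0 1 :: 'a::semiring_1^2^2)"
  by (simp add: mat2_def mat_def vec_eq_iff forall_2 vector_2)

lemma invertible_mat2I:
  fixes p :: "'a::semiring_1"
  assumes "mat2 p q r s ** mat2 p' q' r' s' = mat 1"
    and "mat2 p' q' r' s' ** mat2 p q r s = mat 1"
  shows "invertible (mat2 p q r s)"
  using assms unfolding invertible_def by blast

lemma mat_commutator_conj:
  fixes x y s t :: "'a::ring_1^'n^'n"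
  assumes "t ** s = mat 1"
  shows "mat_commutator (s ** x ** t) (s ** y ** t) = s ** mat_commutator x y ** t"
proof -
  have "(s ** u ** t) ** (s ** v ** t) = s ** (u ** v) ** t" for u v :: "'a^'n^'n"
  proof -
    have "(s ** u ** t) ** (s ** v ** t) = s ** u ** (t ** s) ** v ** t"
      by (simp only: matrix_mul_assoc)
    then show ?thesis
      by (simp add: assms matrix_mul_assoc)
  qed
  moreover have "s ** (u - v) ** t = s ** u ** t - s ** v ** t" for u v :: "'a^'n^'n"
    by (simp add: matrix_matrix_mult_def vec_eq_iff sum_subtractf right_diff_distrib left_diff_distrib)
  ultimately show ?thesis
    unfolding mat_commutator_def by simp
qed

lemma invertible_conj:
  fixes x s t :: "'a::semiring_1^'n^'n"
  assumes "t ** s = mat 1" "s ** t = mat 1" "invertible x"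
  shows "invertible (s ** x ** t)"
proof -
  have "invertible s" "invertible t"
    using assms unfolding invertible_def by blast+
  then show ?thesis
    by (intro invertible_mult assms)
qed

definition invertible_commutator_product :: "'a::ring_1^'n^'n \<Rightarrow> bool" where
  "invertible_commutator_product a \<longleftrightarrow>
    (\<exists>b c d e. a = mat_commutator b c ** mat_commutator d e
      \<and> invertible (mat_commutator b c) \<and> invertible d)"

text \<open>Stated as a reduction: to treat \<open>a\<close> it suffices to treat a similar matrix,
  since conjugating back all four witnesses preserves commutators and invertibility.\<close>

lemma invertible_commutator_product_conj:
  fixes a s t :: "'a::ring_1^'n^'n"
  assumes st: "s ** t = mat 1" and ts: "t ** s = mat 1"
    and conj: "invertible_commutator_product (s ** a ** t)"
  shows "invertible_commutator_product a"
proof -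
  obtain b c d e where
    eq: "s ** a ** t = mat_commutator b c ** mat_commutator d e"
    and inv: "invertible (mat_commutator b c)" "invertible d"
    using conj unfolding invertible_commutator_product_def by blast
  have "a = (t ** s) ** a ** (t ** s)"
    by (simp add: ts)
  also have "\<dots> = t ** (s ** a ** t) ** s"
    by (simp only: matrix_mul_assoc)
  \<comment> \<open>Inserting \<open>s ** t = mat 1\<close> between the two commutators lets each be
    conjugated separately.\<close>
  also have "\<dots> = t ** mat_commutator b c ** (s ** t) ** mat_commutator d e ** s"
    unfolding eq by (simp add: st matrix_mul_assoc)
  also have "\<dots> = (t ** mat_commutator b c ** s) ** (t ** mat_commutator d e ** s)"
    by (simp only: matrix_mul_assoc)
  also have "\<dots> = mat_commutator (t ** b ** s) (t ** c ** s)
      ** mat_commutator (t ** d ** s) (t ** e ** s)"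
    by (simp add: mat_commutator_conj st)
  finally have "a = \<dots>" .
  moreover have "invertible (mat_commutator (t ** b ** s) (t ** c ** s))"
    by (simp add: mat_commutator_conj[OF st] invertible_conj[OF st ts] inv)
  ultimately show ?thesis
    unfolding invertible_commutator_product_def
    using invertible_conj[OF st ts inv(2)] by blast
qed

text \<open>Commuting with diag(1, 0) kills the diagonal, so its entry \<open>p\<close> can be
  chosen freely to make \<open>d\<close> invertible: \<open>p = 0\<close> gives an antidiagonal
  matrix with nonzero entries, and \<open>p = 1\<close> a unitriangular one when \<open>x\<close> or
  \<open>y\<close> vanishes.\<close>

lemma zero_diagonal_commutator:
  fixes x y :: "'a::division_ring"
  obtains d e where "mat2 0 x y 0 = mat_commutator d e" "invertible d"
proof -
  have comm: "mat2 0 x y 0 = mat_commutator (mat2 p (- x) y p) (mat2 1 0 0 0)" for p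
    by (simp add: mat_commutator_def mat2_mult mat2_diff)
  consider "x \<noteq> 0" "y \<noteq> 0" | "x = 0" | "y = 0"
    by blast
  then show thesis
  proof cases
    case 1
    have "invertible (mat2 0 (- x) y 0)"
      by (rule invertible_mat2I[where p' = 0 and q' = "inverse y" and r' = "- inverse x" and s' = 0])
        (use 1 in \<open>simp_all add: mat2_mult mat2_one\<close>)
    then show thesis using that comm by blast
  next
    case 2
    have "invertible (mat2 1 (- x) y 1)"
      by (rule invertible_mat2I[where p' = 1 and q' = 0 and r' = "- y" and s' = 1])
        (use 2 in \<open>simp_all add: mat2_mult mat2_one\<close>)
    then show thesis using that comm by blast
  next
    case 3
    have "invertible (mat2 1 (- x) y 1)"
      by (rule invertible_mat2I[where p' = 1 and q' = x and r' = 0 and s' = 1])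
        (use 3 in \<open>simp_all add: mat2_mult mat2_one\<close>)
    then show thesis using that comm by blast
  qed
qed

text \<open>The right factor is now settled; for each form of matrix it remains to find an
  invertible commutator to put on its left.\<close>

lemma invertible_commutator_product_times_zero_diagonal:
  fixes x y :: "'a::division_ring"
  assumes "invertible (mat_commutator b c)"
  shows "invertible_commutator_product (mat_commutator b c ** mat2 0 x y 0)"
proof -
  obtain d e where "mat2 0 x y 0 = mat_commutator d e" "invertible d"
    by (rule zero_diagonal_commutator)
  then have "mat_commutator b c ** mat2 0 x y 0 = mat_commutator b c ** mat_commutator d e"
    by simp
  with assms \<open>invertible d\<close> show ?thesis
    unfolding invertible_commutator_product_def by blast
qed

text \<open>Swapping the rows of a diagonal matrix makes its diagonal zero, and the swap is itself
  an invertible commutator.\<close>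

lemma invertible_commutator_product_diagonal:
  fixes p s :: "'a::division_ring"
  shows "invertible_commutator_product (mat2 p 0 0 s)"
proof -
  have comm: "mat_commutator (mat2 0 (-1) 1 0) (mat2 1 0 0 0) = (mat2 0 1 1 0 :: 'a^2^2)"
    by (simp add: mat_commutator_def mat2_mult mat2_diff)
  have "invertible (mat2 0 1 1 0 :: 'a^2^2)"
    by (rule invertible_mat2I[where p' = 0 and q' = 1 and r' = 1 and s' = 0])
      (simp_all add: mat2_mult mat2_one)
  then have "invertible_commutator_product (mat2 0 1 1 0 ** mat2 0 s p 0)"
    unfolding comm[symmetric] by (rule invertible_commutator_product_times_zero_diagonal)
  then show ?thesis
    by (simp add: mat2_mult)
qed

lemma invertible_commutator_product_left_multiple:
  fixes b c w :: "'a::division_ring"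
  shows "invertible_commutator_product (mat2 0 b c (w * b))"
proof -
  have comm: "mat_commutator (mat2 0 1 0 w) (mat2 0 0 1 0) = mat2 1 0 w (-1)"
    by (simp add: mat_commutator_def mat2_mult mat2_diff)
  \<comment> \<open>This matrix is an involution, hence its own inverse.\<close>
  have "invertible (mat2 1 0 w (-1))"
    by (rule invertible_mat2I[where p' = 1 and q' = 0 and r' = w and s' = "-1"])
      (simp_all add: mat2_mult mat2_one)
  then have "invertible_commutator_product (mat2 1 0 w (-1) ** mat2 0 b (- c) 0)"
    unfolding comm[symmetric] by (rule invertible_commutator_product_times_zero_diagonal)
  then show ?thesis
    by (simp add: mat2_mult)
qed

lemma invertible_commutator_product_zero_corner:
  fixes b c d :: "'a::division_ring"
  shows "invertible_commutator_product (mat2 0 b c d)"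
proof -
  consider "b \<noteq> 0" | "b = 0" "d = 0" | "b = 0" "d \<noteq> 0"
    by blast
  then show ?thesis
  proof cases
    \<comment> \<open>Here \<open>d = (d * inverse b) * b\<close> is a left multiple of
      \<open>b\<close>.\<close>
    case 1
    then show ?thesis
      using invertible_commutator_product_left_multiple[of b c "d * inverse b"]
      by (simp add: mult.assoc)
  next
    case 2
    then show ?thesis
      using invertible_commutator_product_left_multiple[of b c 0] by simp
  next
    case 3
    \<comment> \<open>With a zero first row, conjugation replaces \<open>c\<close> by
      \<open>c - d * t\<close>, so this \<open>t\<close> makes the matrix diagonal.\<close>
    define t where "t = inverse d * c"
    have "mat2 1 0 t 1 ** mat2 0 b c d ** mat2 1 0 (- t) 1 = mat2 0 0 0 d"
      using 3 by (simp add: mat2_mult t_def mult.assoc[symmetric])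
    then have "invertible_commutator_product (mat2 1 0 t 1 ** mat2 0 b c d ** mat2 1 0 (- t) 1)"
      by (simp add: invertible_commutator_product_diagonal)
    then show ?thesis
      by (rule invertible_commutator_product_conj[rotated 2]) (simp_all add: mat2_mult mat2_one)
  qed
qed

lemma invertible_commutator_product_lower_nonzero:
  fixes p q r s :: "'a::division_ring"
  assumes "r \<noteq> 0"
  shows "invertible_commutator_product (mat2 p q r s)"
proof -
  \<comment> \<open>Chosen to solve \<open>p + t * r = 0\<close>, so that adding \<open>t\<close>
    times the second row to the first clears the corner; the column operation that completes the
    conjugation leaves the first column alone.\<close>
  define t where "t = - (p * inverse r)"
  have "mat2 1 t 0 1 ** mat2 p q r s ** mat2 1 (- t) 0 1 = mat2 0 (q + t * s) r (r * (p * inverse r) + s)"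
    using assms by (simp add: mat2_mult t_def mult.assoc)
  then have "invertible_commutator_product (mat2 1 t 0 1 ** mat2 p q r s ** mat2 1 (- t) 0 1)"
    by (simp add: invertible_commutator_product_zero_corner)
  then show ?thesis
    by (rule invertible_commutator_product_conj[rotated 2]) (simp_all add: mat2_mult mat2_one)
qed

lemma invertible_commutator_product_mat2:
  fixes a :: "'a::division_ring^2^2"
  shows "invertible_commutator_product a"
proof -
  obtain p q r s where a: "a = mat2 p q r s"
    using mat2_eta by blast
  consider "r \<noteq> 0" | "q \<noteq> 0" | "q = 0" "r = 0"
    by blast
  then show ?thesis
  proof cases
    case 1
    then show ?thesis
      by (simp add: a invertible_commutator_product_lower_nonzero)
  next
    case 2
    \<comment> \<open>Conjugating by the swap, which is its own inverse, moves \<open>q\<close> to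
      the lower left position.\<close>
    then have "invertible_commutator_product (mat2 0 1 1 0 ** a ** mat2 0 1 1 0)"
      by (simp add: a mat2_mult invertible_commutator_product_lower_nonzero)
    then show ?thesis
      by (rule invertible_commutator_product_conj[rotated 2])
        (simp_all add: mat2_mult mat2_one)
  next
    case 3
    then show ?thesis
      by (simp add: a invertible_commutator_product_diagonal)
  qed
qed

theorem proposition4p2:
  fixes a :: "'a::division_ring^2^2"
  shows "(\<exists>b c d e :: 'a^2^2. a = mat_commutator b c ** mat_commutator d e
            \<and> invertible (mat_commutator b c) \<and> invertible d)
       \<and> (\<exists>b c d e :: 'a^2^2. a = mat_commutator b c ** mat_commutator d e)"
  using invertible_commutator_product_mat2[of a]
  unfolding invertible_commutator_product_def by blast

end
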